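(* For every integer $m\ge 0$, the function $x\mapsto 1/V_m(x)$ is convex on $[0,\infty)$.
   Context: For real $m>-1$ and $x>0$, $V_m(x)=\frac{2e^{x^2}}{\Gamma(m+1)}\int_x^\infty (t^2-x^2)^m e^{-t^2}\,dt=\frac{1}{\Gamma(m+1)}\int_0^\infty \frac{u^m e^{-u}}{\sqrt{x^2+u}}\,du$. For $m>-\frac12$ the second formula also defines $V_m(0)$ (a finite value). In the paper $\mathbf{N}$ includes $0$. *)

theory Defs
  imports "HOL-Analysis.Analysis"
begin

text \<open>
  The formula in the variable \<open>u\<close> is the one that also makes sense for \<open>x = 0\<close>, so it is
  taken as the definition; \<open>V_alt\<close> below gives the form valid for \<open>x > 0\<close>, and
  \<open>V_integrable\<close> shows that the integral is a finite one in both cases. The range of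
  integration is open so that the totalised value of the integrand at \<open>u = 0\<close> plays no role.
\<close>

definition V :: "real \<Rightarrow> real \<Rightarrow> real" where
  "V m x = 1 / Gamma (m + 1) * integral {0<..} (\<lambda>u. u powr m * exp (- u) / sqrt (x\<^sup>2 + u))"

lemma V_integrable:
  assumes "x > 0 \<and> m > -1 \<or> x = 0 \<and> m > -1/2"
  shows "(\<lambda>u. u powr m * exp (- u) / sqrt (x\<^sup>2 + u)) absolutely_integrable_on {0<..}"
proof -
  define a where "a = (if x > 0 then m else m - 1/2)"
  define c where "c = (if x > 0 then 1 / x else 1)"
  have a: "a > -1" using assms by (auto simp: a_def)
  have "((\<lambda>t. t powr a / exp t) has_integral Gamma (a + 1)) {0..}"
    using Gamma_integral_real[of "a + 1"] a by simp
  then have "(\<lambda>t. t powr a / exp t) integrable_on {0..}"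
    by (rule has_integral_integrable)
  then have int: "(\<lambda>t. t powr a / exp t) integrable_on {0<..}"
    by (rule integrable_spike_set) (auto intro: negligible_subset[of "{0}"])
  show ?thesis
  proof (rule measurable_bounded_by_integrable_imp_absolutely_integrable)
    show "(\<lambda>t. c * (t powr a / exp t)) integrable_on {0<..}"
      using int by (rule integrable_on_mult_right)
    have "continuous_on {0<..} (\<lambda>u. u powr m * exp (- u) / sqrt (x\<^sup>2 + u))"
      by (intro continuous_intros) (auto simp: add_nonneg_eq_0_iff)
    then show "(\<lambda>u. u powr m * exp (- u) / sqrt (x\<^sup>2 + u))
                 \<in> borel_measurable (lebesgue_on {0<..})"
      by (rule continuous_imp_measurable_on_sets_lebesgue) simp
    fix u :: real assume u: "u \<in> {0<..}"
    show "norm (u powr m * exp (- u) / sqrt (x\<^sup>2 + u)) \<le> c * (u powr a / exp u)"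
    proof (cases "x > 0")
      case True
      have "x \<le> sqrt (x\<^sup>2 + u)" using u by (intro real_le_rsqrt) simp
      then have "u powr m * exp (- u) / sqrt (x\<^sup>2 + u) \<le> u powr m * exp (- u) / x"
        using True u by (intro divide_left_mono mult_pos_pos) (auto intro: add_pos_pos)
      then show ?thesis
        using True u by (simp add: a_def c_def exp_minus divide_inverse mult_ac)
    next
      case False
      then have "x = 0" using assms by auto
      then have "u powr a = u powr m / sqrt u"
        using u by (simp add: a_def powr_diff powr_half_sqrt)
      with \<open>x = 0\<close> show ?thesis
        using u by (simp add: c_def exp_minus divide_inverse mult_ac)
    qed
  qed simp
qed

lemma V_alt:
  assumes "m > -1" "x > 0"
  shows "V m x = 2 * exp (x\<^sup>2) / Gamma (m + 1) *
           integral {x<..} (\<lambda>t. (t\<^sup>2 - x\<^sup>2) powr m * exp (- t\<^sup>2))"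
proof -
  let ?f = "\<lambda>u. u powr m * exp (- u) / sqrt (x\<^sup>2 + u)"
  have im: "(\<lambda>t. t\<^sup>2 - x\<^sup>2) ` {x<..} = {0<..}"
  proof (intro equalityI subsetI)
    fix u assume "u \<in> (\<lambda>t. t\<^sup>2 - x\<^sup>2) ` {x<..}"
    then show "u \<in> {0<..}" using assms by (auto intro!: power_strict_mono)
  next
    fix u :: real assume "u \<in> {0<..}"
    then have "u = (sqrt (x\<^sup>2 + u))\<^sup>2 - x\<^sup>2" "sqrt (x\<^sup>2 + u) \<in> {x<..}"
      using assms by (auto intro: real_less_rsqrt)
    then show "u \<in> (\<lambda>t. t\<^sup>2 - x\<^sup>2) ` {x<..}" by blast
  qed
  have inj: "inj_on (\<lambda>t. t\<^sup>2 - x\<^sup>2) {x<..}"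
    using assms by (auto simp: inj_on_def)
  have der: "((\<lambda>t. t\<^sup>2 - x\<^sup>2) has_field_derivative 2 * t) (at t within {x<..})" for t
    by (auto intro!: derivative_eq_intros)
  have "?f absolutely_integrable_on (\<lambda>t. t\<^sup>2 - x\<^sup>2) ` {x<..}"
    unfolding im using V_integrable assms by blast
  then have "integral ((\<lambda>t. t\<^sup>2 - x\<^sup>2) ` {x<..}) ?f
               = integral {x<..} (\<lambda>t. \<bar>2 * t\<bar> * ?f (t\<^sup>2 - x\<^sup>2))"
    using has_absolute_integral_change_of_variables_1'
      [OF _ der inj, of ?f "integral ((\<lambda>t. t\<^sup>2 - x\<^sup>2) ` {x<..}) ?f"]
    by (metis lborelD sets_completionI_sets greaterThan_borel sets_lborel)
  then have "integral {0<..} ?f = integral {x<..} (\<lambda>t. \<bar>2 * t\<bar> * ?f (t\<^sup>2 - x\<^sup>2))"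
    by (simp only: im)
  also have "\<dots> = integral {x<..} (\<lambda>t. 2 * exp (x\<^sup>2) * ((t\<^sup>2 - x\<^sup>2) powr m * exp (- t\<^sup>2)))"
    using assms by (intro integral_cong) (auto simp: exp_diff exp_minus field_simps)
  finally show ?thesis by (simp add: V_def)
qed

end

theory Submission
  imports Defs "HOL-Real_Asymp.Real_Asymp"
begin

text \<open>
  For \<open>x > 0\<close> the reciprocal \<open>1 / V\<close> has second derivative \<open>(2 V'\<^sup>2 - V V'') / V ^ 3\<close>, so
  convexity there is the inequality \<open>K \<ge> 0\<close> with \<open>K = 2 V'\<^sup>2 - V V''\<close>. It holds because \<open>V\<close> is a
  positive decreasing solution of the Kummer-type equation
  \<open>V'' = 2 V + 2 (x + m / x) V'\<close>, which results from differentiating under the integral sign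
  (\<open>kern_integral_deriv\<close>) and one integration by parts (\<open>kern_integral_by_parts\<close>).

  The sign of \<open>K\<close> follows from monotonicity. By the equation, multiplying \<open>K\<close> by
  \<open>V x\<^bsup>-2m\<^esup> exp (-x\<^sup>2)\<close> gives a function \<open>G\<close> with
  \<open>G' = 2 x\<^bsup>-2\<^esup> (m V\<^sup>2 + x\<^sup>2 V'\<^sup>2) V' x\<^bsup>-2m\<^esup> exp (-x\<^sup>2) \<le> 0\<close>.
  On the other hand \<open>V V' \<le> 0\<close> yields \<open>K \<ge> -2 V\<^sup>2\<close>, and \<open>V\<close> is bounded at infinity, so \<open>G\<close> has a
  lower bound tending to 0 there. A nonincreasing function with such a bound is nonnegative, hence
  \<open>K \<ge> 0\<close> (\<open>ode_solution_reciprocal_convex\<close>). The argument works for every real \<open>m \<ge> 0\<close>.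

  The end point 0 is reached by a limit of the convexity inequality for the translates
  \<open>x \<mapsto> 1 / V (x + 1 / n)\<close>. This avoids derivatives at 0, where \<open>V\<close>, an even
  function of \<open>x\<close>, has a corner for \<open>m = 0\<close>.
\<close>

section \<open>Differentiation under the integral sign\<close>

text \<open>
  By the mean value theorem the bound on \<open>f'\<close> also bounds the difference quotients, so that dominated
  convergence applies to them along every sequence approaching \<open>x\<close>.
\<close>

lemma has_field_derivative_integral_dominated:
  fixes f f' :: "real \<Rightarrow> real \<Rightarrow> real"
  assumes T: "open T" "convex T" "x \<in> T"
    and int: "\<And>t. t \<in> T \<Longrightarrow> f t integrable_on S"
    and deriv: "\<And>t u. t \<in> T \<Longrightarrow> u \<in> S \<Longrightarrow> ((\<lambda>t. f t u) has_real_derivative f' t u) (at t)"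
    and bound: "\<And>t u. t \<in> T \<Longrightarrow> u \<in> S \<Longrightarrow> \<bar>f' t u\<bar> \<le> g u"
    and g: "g integrable_on S"
  shows "((\<lambda>t. integral S (f t)) has_real_derivative integral S (f' x)) (at x)"
proof -
  have "((\<lambda>t. integral S (f t)) has_real_derivative integral S (f' x)) (at x within T)"
    unfolding has_field_derivative_iff tendsto_at_iff_sequentially comp_def
  proof (intro allI impI)
    fix X :: "nat \<Rightarrow> real"
    assume X: "\<forall>i. X i \<in> T - {x}" "X \<longlonglongrightarrow> x"
    define q where "q k u = (f (X k) u - f x u) / (X k - x)" for k u
    have quot: "integral S (q k) = (integral S (f (X k)) - integral S (f x)) / (X k - x)" for k
      unfolding q_def using X T int by (simp add: integral_diff)
    have "(\<lambda>k. integral S (q k)) \<longlonglongrightarrow> integral S (f' x)"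
    proof (rule dominated_convergence(2))
      show "q k integrable_on S" for k
        unfolding q_def using X T int by (intro integrable_on_divide integrable_diff) auto
      show "g integrable_on S" by fact
      show "norm (q k u) \<le> g u" if u: "u \<in> S" for k u
      proof -
        have "norm (f (X k) u - f x u) \<le> g u * norm (X k - x)"
          using X T u deriv bound
          by (intro field_differentiable_bound[of T _ "\<lambda>t. f' t u"])
             (auto intro: has_field_derivative_at_within)
        then show ?thesis using X by (simp add: q_def divide_le_eq)
      qed
      show "(\<lambda>k. q k u) \<longlonglongrightarrow> f' x u" if u: "u \<in> S" for u
        using has_field_derivative_at_within[OF deriv[OF \<open>x \<in> T\<close> u], of T] X
        unfolding has_field_derivative_iff tendsto_at_iff_sequentially comp_def q_def by blast
    qed
    then show "(\<lambda>k. (integral S (f (X k)) - integral S (f x)) / (X k - x)) \<longlonglongrightarrow> integral S (f' x)"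
      by (simp add: quot)
  qed
  then show ?thesis using at_within_open[OF T(3) T(1)] by simp
qed

section \<open>The integrals that define \<open>V\<close> and its derivatives\<close>

text \<open>
  Differentiating \<open>V\<close> in \<open>x\<close> produces the same integrand with higher powers of
  \<open>x\<^sup>2 + u\<close> in the denominator; the exponent \<open>p\<close> keeps track of them. Up to the factor
  \<open>Gamma (m + 1)\<close>, \<open>V\<close> is the integral with \<open>p = 1/2\<close>.
\<close>

definition kern :: "real \<Rightarrow> real \<Rightarrow> real \<Rightarrow> real \<Rightarrow> real" where
  "kern m p x u = u powr m * exp (- u) * (x\<^sup>2 + u) powr (- p)"

lemma Gamma_weight_integrable:
  assumes "m > -1"
  shows "(\<lambda>u::real. u powr m * exp (- u)) integrable_on {0<..}"
proof -
  have "(\<lambda>u. u powr m / exp u) integrable_on {0..}"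
    using Gamma_integral_real[of "m + 1"] assms by (auto dest: has_integral_integrable)
  then have "(\<lambda>u. u powr m / exp u) integrable_on {0<..}"
    by (rule integrable_spike_set) (auto intro: negligible_subset[of "{0}"])
  then show ?thesis by (simp add: exp_minus divide_inverse)
qed

lemma continuous_on_kern: "continuous_on {0<..} (kern m p x)"
  unfolding kern_def
  by (intro continuous_intros) (auto simp: add_nonneg_eq_0_iff)

text \<open>
  A majorant that is uniform in \<open>x\<close> away from 0; it gives integrability, and domination for the
  derivative under the integral sign.
\<close>

lemma kern_le:
  assumes "0 < y" "y \<le> x" "0 < u" "0 \<le> p"
  shows "kern m p x u \<le> y powr (- 2 * p) * (u powr m * exp (- u))"
proof -
  have "(x\<^sup>2 + u) powr (- p) \<le> (y\<^sup>2) powr (- p)"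
    using assms by (intro powr_mono2') (auto intro: add_increasing2 power_mono)
  also have "(y\<^sup>2) powr (- p) = y powr (- 2 * p)"
    using assms by (simp flip: powr_numeral add: powr_powr)
  finally show ?thesis
    by (simp add: kern_def mult.commute mult_left_mono)
qed

lemma kern_absolutely_integrable:
  assumes "m > -1" "x > 0" "p \<ge> 0"
  shows "kern m p x absolutely_integrable_on {0<..}"
proof (rule measurable_bounded_by_integrable_imp_absolutely_integrable)
  show "(\<lambda>u. x powr (- 2 * p) * (u powr m * exp (- u))) integrable_on {0<..}"
    using Gamma_weight_integrable assms by (intro integrable_on_mult_right) auto
  show "kern m p x \<in> borel_measurable (lebesgue_on {0<..})"
    by (rule continuous_imp_measurable_on_sets_lebesgue[OF continuous_on_kern]) simp
  show "norm (kern m p x u) \<le> x powr (- 2 * p) * (u powr m * exp (- u))" if "u \<in> {0<..}" for u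
    using kern_le[of x x u p m] assms that by (simp add: kern_def abs_mult)
qed simp

lemma kern_integrable:
  assumes "m > -1" "x > 0" "p \<ge> 0"
  shows "kern m p x integrable_on {0<..}"
  using kern_absolutely_integrable[OF assms] set_lebesgue_integral_eq_integral(1) by blast

lemma kern_integral_pos:
  assumes int: "kern m p x integrable_on {0<..}"
  shows "integral {0<..} (kern m p x) > 0"
proof (rule ccontr)
  assume "\<not> ?thesis"
  \<comment> \<open>A vanishing integral over the half-line would vanish over \<open>[1, 2]\<close>, where the integrand is
    continuous and positive.\<close>
  moreover have "integral {0<..} (kern m p x) \<ge> 0"
    by (intro integral_nonneg int) (simp add: kern_def)
  ultimately have 0: "integral {0<..} (kern m p x) = 0" by simp
  have "integral {1..2} (kern m p x) \<le> integral {0<..} (kern m p x)"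
    by (intro integral_subset_le integrable_continuous_interval
              continuous_on_subset[OF continuous_on_kern] int)
       (auto simp: kern_def)
  moreover have "integral {1..2} (kern m p x) \<ge> 0"
    by (intro integral_nonneg integrable_continuous_interval
              continuous_on_subset[OF continuous_on_kern]) (auto simp: kern_def)
  ultimately have "integral (cbox 1 2) (kern m p x) = 0" using 0 by simp
  moreover have "continuous_on (cbox 1 2) (kern m p x)"
    by (rule continuous_on_subset[OF continuous_on_kern]) auto
  ultimately have "kern m p x 1 = 0"
    by (subst (asm) integral_cbox_eq_0_iff) (auto simp: kern_def)
  then show False by (auto simp: kern_def add_nonneg_eq_0_iff)
qed

lemma kern_integral_deriv:
  assumes "m > -1" "x > 0" "p \<ge> 0"
  shows "((\<lambda>x. integral {0<..} (kern m p x)) has_real_derivative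
           - 2 * p * x * integral {0<..} (kern m (p + 1) x)) (at x)"
proof -
  have "((\<lambda>x. integral {0<..} (kern m p x)) has_real_derivative
           integral {0<..} (\<lambda>u. - 2 * p * x * kern m (p + 1) x u)) (at x)"
  proof (rule has_field_derivative_integral_dominated[where T = "{x/2<..<2*x}"
        and f' = "\<lambda>t u. - 2 * p * t * kern m (p + 1) t u"])
    show "(\<lambda>u. 2 * p * (2 * x) * ((x/2) powr (- 2 * (p + 1)) * (u powr m * exp (- u)))) integrable_on {0<..}"
      using Gamma_weight_integrable assms by (intro integrable_on_mult_right) auto
    fix t u :: real assume tu: "t \<in> {x/2<..<2*x}" "u \<in> {0<..}"
    then have t: "t > 0" using assms by auto
    have pos: "t\<^sup>2 + u > 0" using tu by (simp add: add_nonneg_pos)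
    show "((\<lambda>t. kern m p t u) has_real_derivative - 2 * p * t * kern m (p + 1) t u) (at t)"
      unfolding kern_def using pos
      by (auto intro!: derivative_eq_intros simp: powr_diff powr_minus divide_simps powr_add)
    have "kern m (p + 1) t u \<ge> 0" by (simp add: kern_def)
    then have "\<bar>- 2 * p * t * kern m (p + 1) t u\<bar> = 2 * p * t * kern m (p + 1) t u"
      using t assms by (simp add: abs_mult)
    also have "\<dots> \<le> 2 * p * (2 * x) * ((x/2) powr (- 2 * (p + 1)) * (u powr m * exp (- u)))"
      using kern_le[of "x/2" t u "p + 1" m] tu assms \<open>kern m (p + 1) t u \<ge> 0\<close>
      by (intro mult_mono) auto
    finally show "\<bar>- 2 * p * t * kern m (p + 1) t u\<bar> \<le> \<dots>" .
  qed (use assms in \<open>auto intro!: kern_integrable\<close>)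
  then show ?thesis by simp
qed

text \<open>
  The integrand of the difference of the two sides is the derivative of
  \<open>2 u\<^bsup>m+1\<^esup> exp (-u) (x\<^sup>2 + u)\<^bsup>-3/2\<^esup>\<close> in \<open>u\<close>, rewritten with
  \<open>u = (x\<^sup>2 + u) - x\<^sup>2\<close>. That function vanishes at both ends of the half-line, so its derivative
  integrates to 0. In terms of \<open>V\<close> this is the differential equation.
\<close>

lemma kern_integral_by_parts:
  assumes m: "m > -1" and x: "x > 0"
  shows "3 * x\<^sup>2 * integral {0<..} (kern m (5/2) x)
       = 2 * integral {0<..} (kern m (1/2) x)
         + (1 - 2 * m - 2 * x\<^sup>2) * integral {0<..} (kern m (3/2) x)"
proof -
  define F where "F u = 2 * u powr (m + 1) * exp (- u) * (x\<^sup>2 + u) powr (- (3/2))" for u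
  define f where "f u = 3 * x\<^sup>2 * kern m (5/2) x u - 2 * kern m (1/2) x u
                        - (1 - 2 * m - 2 * x\<^sup>2) * kern m (3/2) x u" for u
  note int = kern_integrable[OF m x] 
  have cont: "continuous_on {0<..} f"
    unfolding f_def by (intro continuous_intros continuous_on_kern)
  have "f absolutely_integrable_on {0<..}"
    unfolding f_def
    by (intro set_integral_diff(1) set_integrable_mult_right kern_absolutely_integrable m x) auto
  moreover have "(\<lambda>u. indicator {0<..} u *\<^sub>R f u) \<in> borel_measurable lborel"
    using borel_measurable_continuous_on_indicator[OF _ cont] by simp
  ultimately have f: "set_integrable lborel {0<..} f"
    unfolding set_integrable_def by (simp add: integrable_completion)
  have F: "(F has_real_derivative f u) (at u)" if u: "u > 0" for u
  proof -
    define A where "A = x\<^sup>2 + u"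
    have A: "A > 0" using u by (simp add: A_def add_nonneg_pos)
    \<comment> \<open>With all powers of \<open>A\<close> reduced to the lowest one, the identity is polynomial.\<close>
    have p: "A powr (- (3/2)) = A * A powr (- (5/2))" "A powr (- (1/2)) = A\<^sup>2 * A powr (- (5/2))"
      using A by (simp_all add: powr_mult_base flip: powr_numeral powr_add)
    have "(F has_real_derivative
        2 * ((m + 1) * u powr m * exp (- u) * A powr (- (3/2)) - u powr (m + 1) * exp (- u) * A powr (- (3/2))
         - 3/2 * u powr (m + 1) * exp (- u) * A powr (- (5/2)))) (at u)"
      unfolding F_def A_def using u A
      by (auto intro!: derivative_eq_intros simp: A_def algebra_simps)
    also have "2 * ((m + 1) * u powr m * exp (- u) * A powr (- (3/2)) - u powr (m + 1) * exp (- u) * A powr (- (3/2))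
         - 3/2 * u powr (m + 1) * exp (- u) * A powr (- (5/2))) = f u"
      unfolding f_def kern_def A_def[symmetric] p powr_add using u
      by (simp add: A_def algebra_simps power2_eq_square)
    finally show ?thesis .
  qed
  have "(LBINT u=0..\<infinity>. f u) = 0 - 0"
  proof (rule interval_integral_FTC_integrable)
    show "set_integrable lborel (einterval 0 \<infinity>) f"
      using f by (simp add: zero_ereal_def)
    show "(F has_vector_derivative f u) (at u)" if "0 < ereal u" for u
      using F[of u] that by (simp add: has_real_derivative_iff_has_vector_derivative)
    show "isCont f u" if "0 < ereal u" for u
      using cont that by (simp add: continuous_on_eq_continuous_at)
    have "(F \<longlongrightarrow> 0) (at_right 0)"
      unfolding F_def using m x by real_asymp
    then show "((F \<circ> real_of_ereal) \<longlongrightarrow> 0) (at_right 0)"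
      by (simp add: zero_ereal_def ereal_tendsto_simps1)
    have "(F \<longlongrightarrow> 0) at_top"
      unfolding F_def using m x by real_asymp
    then show "((F \<circ> real_of_ereal) \<longlongrightarrow> 0) (at_left \<infinity>)"
      by (simp add: ereal_tendsto_simps1)
  qed auto
  then have "integral {0<..} f = 0"
    using interval_integral_eq_integral'[of 0 \<infinity> f] f by (simp add: zero_ereal_def)
  moreover have "integral {0<..} f = 3 * x\<^sup>2 * integral {0<..} (kern m (5/2) x)
       - 2 * integral {0<..} (kern m (1/2) x)
       - (1 - 2 * m - 2 * x\<^sup>2) * integral {0<..} (kern m (3/2) x)"
    unfolding f_def
    by (intro integral_unique has_integral_diff has_integral_mult_right integrable_integral int) auto
  ultimately show ?thesis by simp
qed

section \<open>Positive decreasing solutions of the differential equation\<close>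

text \<open>
  The weight \<open>V w\<close> with \<open>w = x\<^bsup>-2m\<^esup> exp (-x\<^sup>2)\<close> is the integrating factor for
  \<open>K = 2 V'\<^sup>2 - V V''\<close>: once \<open>V''\<close> is eliminated, the derivative of \<open>K\<close>
  consists of a multiple of \<open>K\<close>, which the weight cancels, and of a remainder that
  has the sign of \<open>V'\<close>.
\<close>

lemma ode_solution_reciprocal_convex:
  fixes V V' V'' :: "real \<Rightarrow> real"
  assumes m: "m \<ge> 0"
    and V: "\<And>x. x > 0 \<Longrightarrow> (V has_real_derivative V' x) (at x)"
    and V': "\<And>x. x > 0 \<Longrightarrow> (V' has_real_derivative V'' x) (at x)"
    and ode: "\<And>x. x > 0 \<Longrightarrow> V'' x = 2 * V x + 2 * (x + m / x) * V' x"
    and pos: "\<And>x. x > 0 \<Longrightarrow> V x > 0"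
    and decr: "\<And>x. x > 0 \<Longrightarrow> V' x \<le> 0"
    and x0: "x0 > 0"
  shows "V x0 * V'' x0 \<le> 2 * (V' x0)\<^sup>2"
proof -
  define b where "b x = x + m / x" for x
  define w where "w x = x powr (- 2 * m) * exp (- x\<^sup>2)" for x :: real
  \<comment> \<open>By the equation this is \<open>2 V'\<^sup>2 - V V''\<close>; the form without \<open>V''\<close> can be
    differentiated once more.\<close>
  define K where "K x = 2 * (V' x)\<^sup>2 - 2 * (V x)\<^sup>2 - 2 * b x * V x * V' x" for x
  define G where "G x = V x * w x * K x" for x
  \<comment> \<open>A lower bound of \<open>G\<close> on \<open>[x0, \<infinity>)\<close> that tends to 0.\<close>
  define B where "B x = - 2 * V x0 ^ 3 * w x" for x
  have G: "(G has_real_derivative 2 / x\<^sup>2 * (m * (V x)\<^sup>2 + x\<^sup>2 * (V' x)\<^sup>2) * V' x * w x) (at x)"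
    if x: "x > 0" for x
  proof -
    note dV = V[OF x] and dV' = V'[OF x]
    have db: "(b has_real_derivative 1 - m / x\<^sup>2) (at x)"
      unfolding b_def using x by (auto intro!: derivative_eq_intros simp: power2_eq_square)
    have dw: "(w has_real_derivative - 2 * b x * w x) (at x)"
      unfolding w_def b_def using x
      by (auto intro!: derivative_eq_intros simp: powr_diff field_simps power2_eq_square)
    have dK: "(K has_real_derivative 4 * V' x * V'' x - 4 * V x * V' x
        - 2 * (1 - m / x\<^sup>2) * V x * V' x - 2 * b x * ((V' x)\<^sup>2 + V x * V'' x)) (at x)"
      unfolding K_def
      by (rule derivative_eq_intros dV dV' db refl)+ (simp add: power2_eq_square algebra_simps)
    have "(G has_real_derivative (V' x * w x + V x * (- 2 * b x * w x)) * K x + V x * w x *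
       (4 * V' x * V'' x - 4 * V x * V' x
        - 2 * (1 - m / x\<^sup>2) * V x * V' x - 2 * b x * ((V' x)\<^sup>2 + V x * V'' x))) (at x)"
      unfolding G_def
      by (rule derivative_eq_intros dV dw dK refl)+ (simp add: algebra_simps)
    also have "(V' x * w x + V x * (- 2 * b x * w x)) * K x + V x * w x *
       (4 * V' x * V'' x - 4 * V x * V' x
        - 2 * (1 - m / x\<^sup>2) * V x * V' x - 2 * b x * ((V' x)\<^sup>2 + V x * V'' x))
      = 2 * (m / x\<^sup>2 * (V x)\<^sup>2 + (V' x)\<^sup>2) * V' x * w x"
      unfolding ode[OF x, folded b_def] K_def
      by (simp add: power2_eq_square algebra_simps)
    also have "\<dots> = 2 / x\<^sup>2 * (m * (V x)\<^sup>2 + x\<^sup>2 * (V' x)\<^sup>2) * V' x * w x"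
      using x by (simp add: field_simps)
    finally show ?thesis .
  qed
  have G_antimono: "G x \<le> G x0" if "x \<ge> x0" for x
  proof (rule DERIV_nonpos_imp_nonincreasing[OF that])
    fix t assume "x0 \<le> t"
    then have "t > 0" using x0 by simp
    moreover have "2 / t\<^sup>2 * (m * (V t)\<^sup>2 + t\<^sup>2 * (V' t)\<^sup>2) * V' t * w t \<le> 0"
      using m decr[OF \<open>t > 0\<close>] 
      by (intro mult_nonpos_nonneg mult_nonneg_nonpos) (auto simp: w_def)
    ultimately show "\<exists>y. (G has_real_derivative y) (at t) \<and> y \<le> 0" using G by blast
  qed
  have B_le: "B x \<le> G x" if "x \<ge> x0" for x
  proof -
    have x: "x > 0" using that x0 by simp
    have "V x \<le> V x0"
      using that x0 V decr by (intro DERIV_nonpos_imp_nonincreasing[OF that]) (meson less_le_trans)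
    then have "V x ^ 3 \<le> V x0 ^ 3" using pos[OF x] by (intro power_mono) auto
    moreover have "w x \<ge> 0" by (simp add: w_def)
    ultimately have "- 2 * V x0 ^ 3 * w x \<le> - 2 * V x ^ 3 * w x"
      by (simp add: mult_right_mono)
    also have "\<dots> = V x * w x * (- 2 * (V x)\<^sup>2)" by (simp add: power2_eq_square power3_eq_cube)
    also have "\<dots> \<le> V x * w x * K x"
    proof (intro mult_left_mono)
      have "b x * V x * V' x \<le> 0"
        using x m pos[OF x] decr[OF x] by (intro mult_nonneg_nonpos) (auto simp: b_def)
      then show "- 2 * (V x)\<^sup>2 \<le> K x"
        using zero_le_power2[of "V' x"] unfolding K_def by linarith
    qed (use pos[OF x] \<open>w x \<ge> 0\<close> in auto)
    finally show ?thesis by (simp add: B_def G_def)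
  qed
  have "(w \<longlongrightarrow> 0) at_top" unfolding w_def by real_asymp
  then have "(B \<longlongrightarrow> - 2 * V x0 ^ 3 * 0) at_top" unfolding B_def by (intro tendsto_intros)
  moreover have "eventually (\<lambda>x. B x \<le> G x0) at_top"
    using eventually_ge_at_top[of x0] by eventually_elim (use G_antimono B_le order_trans in blast)
  ultimately have "0 \<le> G x0" using tendsto_upperbound[of B] by fastforce
  moreover have "V x0 * w x0 > 0" using pos x0 by (simp add: w_def)
  ultimately have "K x0 \<ge> 0" by (simp add: G_def zero_le_mult_iff)
  then show ?thesis using ode[OF x0] by (simp add: K_def b_def power2_eq_square algebra_simps)
qed

section \<open>Convexity of the reciprocal\<close>

lemma kern_half:
  assumes "u > 0"
  shows "kern m (1/2) x u = u powr m * exp (- u) / sqrt (x\<^sup>2 + u)"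
proof -
  have "(x\<^sup>2 + u) powr (- (1/2)) = inverse (sqrt (x\<^sup>2 + u))"
    using assms by (subst powr_minus) (simp add: powr_half_sqrt)
  then show ?thesis by (simp only: kern_def divide_inverse)
qed

lemma V_eq_kern_integral: "V m x = integral {0<..} (kern m (1/2) x) / Gamma (m + 1)"
proof -
  have "integral {0<..} (\<lambda>u. u powr m * exp (- u) / sqrt (x\<^sup>2 + u)) = integral {0<..} (kern m (1/2) x)"
    by (rule integral_cong) (simp add: kern_half)
  then show ?thesis by (simp add: V_def)
qed

lemma convex_on_inverse_V_pos:
  assumes m: "m \<ge> 0"
  shows "convex_on {0<..} (\<lambda>x. 1 / V m x)"
proof -
  define c where "c = Gamma (m + 1)"
  define J where "J p x = integral {0<..} (kern m p x)" for p x
  define U where "U = J (1/2)"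
  define U' where "U' x = - x * J (3/2) x" for x
  define U'' where "U'' x = 3 * x\<^sup>2 * J (5/2) x - J (3/2) x" for x
  have c: "c > 0" using m by (simp add: c_def Gamma_real_pos)
  have J: "J p x > 0" if "x > 0" "p \<ge> 0" for p x
    unfolding J_def using kern_integral_pos kern_integrable m that by simp
  have dJ: "(J p has_real_derivative - 2 * p * x * J (p + 1) x) (at x)" if "x > 0" "p \<ge> 0" for p x
    unfolding J_def using kern_integral_deriv[of m x p] m that by simp
  have dU: "(U has_real_derivative U' x) (at x)" if "x > 0" for x
    using dJ[of x "1/2"] that by (simp add: U_def U'_def)
  have dU': "(U' has_real_derivative U'' x) (at x)" if "x > 0" for x
    unfolding U'_def U''_def using that dJ[of x "3/2"]
    by (auto intro!: derivative_eq_intros simp: power2_eq_square)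
  have ode: "U'' x = 2 * U x + 2 * (x + m / x) * U' x" if "x > 0" for x
  proof -
    have "2 * (x + m / x) * U' x = - 2 * (x\<^sup>2 + m) * J (3/2) x"
      using that by (simp add: U'_def field_simps power2_eq_square)
    moreover have "3 * x\<^sup>2 * J (5/2) x = 2 * U x + (1 - 2 * m - 2 * x\<^sup>2) * J (3/2) x"
      using kern_integral_by_parts[of m x] m that by (simp add: U_def J_def)
    ultimately show ?thesis by (simp add: U''_def algebra_simps)
  qed
  have U: "U x > 0" if "x > 0" for x using J[OF that] by (simp add: U_def)
  have U': "U' x \<le> 0" if "x > 0" for x using J[OF that, of "3/2"] that by (simp add: U'_def)
  have "convex_on {0<..} (\<lambda>x. c / U x)"
  proof (rule f''_ge0_imp_convex)
    fix x :: real assume "x \<in> {0<..}"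
    then have x: "x > 0" by simp
    note U0 = U[OF x]
    show "((\<lambda>x. c / U x) has_real_derivative - c * U' x / (U x)\<^sup>2) (at x)"
      using U0 by (auto intro!: derivative_eq_intros dU x simp: power2_eq_square)
    show "((\<lambda>x. - c * U' x / (U x)\<^sup>2) has_real_derivative
            c * (2 * (U' x)\<^sup>2 - U x * U'' x) / U x ^ 3) (at x)"
      using U0 by (auto intro!: derivative_eq_intros dU dU' x
                    simp: power2_eq_square power3_eq_cube divide_simps algebra_simps)
    have "U x * U'' x \<le> 2 * (U' x)\<^sup>2"
      by (rule ode_solution_reciprocal_convex[OF m dU dU' ode U U' x])
    then show "c * (2 * (U' x)\<^sup>2 - U x * U'' x) / U x ^ 3 \<ge> 0"
      using c U0 by simp
  qed simp
  then show ?thesis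
    by (simp add: V_eq_kern_integral U_def J_def c_def)
qed

lemma V_integrand_integrable:
  assumes "m \<ge> 0" "x \<ge> 0"
  shows "(\<lambda>u. u powr m * exp (- u) / sqrt (x\<^sup>2 + u)) integrable_on {0<..}"
proof -
  have "x > 0 \<and> m > -1 \<or> x = 0 \<and> m > -1/2" using assms by auto
  then show ?thesis
    by (intro set_lebesgue_integral_eq_integral(1) V_integrable)
qed

text \<open>
  The integrand increases as \<open>x\<close> decreases to 0, so the one for \<open>x = 0\<close>, which is still integrable,
  dominates all the others.
\<close>

lemma V_tendsto_right:
  assumes m: "m \<ge> 0" and x: "x \<ge> 0"
  shows "(\<lambda>n. V m (x + 1 / real (Suc n))) \<longlonglongrightarrow> V m x"
proof -
  define f where "f x u = u powr m * exp (- u) / sqrt (x\<^sup>2 + u)" for x u :: real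
  have int: "f y integrable_on {0<..}" if "y \<ge> 0" for y
    unfolding f_def using V_integrand_integrable[OF m that] .
  have "(\<lambda>n. integral {0<..} (f (x + 1 / real (Suc n)))) \<longlonglongrightarrow> integral {0<..} (f x)"
  proof (rule dominated_convergence(2))
    show "f 0 integrable_on {0<..}" by (simp add: int)
    show "f (x + 1 / real (Suc n)) integrable_on {0<..}" for n using x by (intro int) simp
    fix u :: real assume u: "u \<in> {0<..}"
    show "norm (f (x + 1 / real (Suc n)) u) \<le> f 0 u" for n
      using u by (auto simp: f_def intro!: divide_left_mono mult_pos_pos add_nonneg_pos)
    have "x\<^sup>2 + u > 0" using u by (simp add: add_nonneg_pos)
    then have "(\<lambda>n. f (x + 1 / real (Suc n)) u) \<longlonglongrightarrow> f (x + 0) u"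
      unfolding f_def by (intro tendsto_intros LIMSEQ_Suc[OF lim_1_over_n]) simp
    then show "(\<lambda>n. f (x + 1 / real (Suc n)) u) \<longlonglongrightarrow> f x u" by simp
  qed
  then show ?thesis unfolding V_def f_def by (intro tendsto_intros)
qed

lemma V_pos:
  assumes m: "m \<ge> 0" and x: "x \<ge> 0"
  shows "V m x > 0"
proof -
  have "kern m (1/2) x integrable_on {0<..}"
    using V_integrand_integrable[OF m x] by (rule integrable_eq) (simp add: kern_half)
  then show ?thesis
    using kern_integral_pos m Gamma_real_pos[of "m + 1"] by (simp add: V_eq_kern_integral)
qed

text \<open>A pointwise limit of convex functions is convex, here of translates by \<open>1 / n\<close>.\<close>

theorem convex_on_inverse_V:
  assumes m: "m \<ge> 0"
  shows "convex_on {0..} (\<lambda>x. 1 / V m x)"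
proof (rule convex_onI)
  fix t x y :: real assume t: "0 < t" "t < 1" and xy: "x \<in> {0..}" "y \<in> {0..}"
  define e where "e n = 1 / real (Suc n)" for n
  have lim: "(\<lambda>n. 1 / V m (z + e n)) \<longlonglongrightarrow> 1 / V m z" if "z \<ge> 0" for z
    unfolding e_def using V_tendsto_right[OF m that] V_pos[OF m that] by (intro tendsto_intros) auto
  let ?z = "(1 - t) * x + t * y"
  have z: "?z \<ge> 0" using t xy by simp
  have le: "1 / V m (?z + e n) \<le> (1 - t) * (1 / V m (x + e n)) + t * (1 / V m (y + e n))" for n
  proof -
    have "e n > 0" by (simp add: e_def)
    then have "1 / V m ((1 - t) *\<^sub>R (x + e n) + t *\<^sub>R (y + e n))
            \<le> (1 - t) * (1 / V m (x + e n)) + t * (1 / V m (y + e n))"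
      using t xy by (intro convex_onD[OF convex_on_inverse_V_pos[OF m]]) auto
    also have "(1 - t) *\<^sub>R (x + e n) + t *\<^sub>R (y + e n) = ?z + e n"
      by (simp add: algebra_simps)
    finally show ?thesis .
  qed
  have limR: "(\<lambda>n. (1 - t) * (1 / V m (x + e n)) + t * (1 / V m (y + e n)))
                \<longlonglongrightarrow> (1 - t) * (1 / V m x) + t * (1 / V m y)"
    using xy by (intro tendsto_intros lim) auto
  have "1 / V m ?z \<le> (1 - t) * (1 / V m x) + t * (1 / V m y)"
    using LIMSEQ_le[OF lim[OF z] limR] le by blast
  then show "1 / V m ((1 - t) *\<^sub>R x + t *\<^sub>R y) \<le> (1 - t) * (1 / V m x) + t * (1 / V m y)"
    by (simp only: real_scaleR_def)
qed simp

theorem theorem23: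
  fixes m :: nat
  shows "convex_on {0..} (\<lambda>x. 1 / V (real m) x)"
  by (rule convex_on_inverse_V) simp

end
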